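(* Let $G$ be a finite simple graph and let $u_1,u_2,w_1,w_2$ be distinct vertices of $G$ such that $N(u_1)\cap N(u_2)\neq\emptyset$ and $N(w_1)\cap N(w_2)\neq\emptyset$. Suppose that (i) $N(u_1)\setminus N(u_2)$, $N(u_2)\setminus N(u_1)$, $N(w_1)\setminus N(w_2)$ and $N(w_2)\setminus N(w_1)$ are all nonempty; (ii) $N(w_1)\setminus N(w_2)\subseteq N(u_1)\setminus N(u_2)$ and $N(u_2)\setminus N(u_1)\subseteq N(w_2)\setminus N(w_1)$; and (iii) $\big|(N(u_1)\setminus N(u_2))\setminus (N(w_1)\setminus N(w_2))\big| + \big|(N(w_2)\setminus N(w_1))\setminus (N(u_2)\setminus N(u_1))\big| \geq 1$. Then $G$ is non-distance magic.
   Context: For a vertex $u$ of a graph $G$, $N(u)=\{v\in V(G): uv\in E(G)\}$ is its open neighbourhood. If $G$ is a simple graph of order $n$, a bijection $f:V(G)\to\{1,2,\ldots,n\}$ is a distance magic labeling of $G$ if $\sum_{v\in N(u)} f(v)$ is the same constant for all $u\in V(G)$. $G$ is distance magic if it has such a labeling, and non-distance magic (NDM) otherwise. *)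

theory Defs
  imports "Graph_Theory.Pair_Digraph"
begin

text \<open>
  A finite simple graph is a \<^locale>\<open>pair_graph\<close>: finite, loop-free, without parallel arcs, and
  symmetric, an undirected edge uv being represented by the two arcs (u, v) and (v, u).
\<close>

definition open_nbhd :: "'a pair_pre_digraph \<Rightarrow> 'a \<Rightarrow> 'a set" where
  "open_nbhd G u = {v \<in> pverts G. (u, v) \<in> parcs G}"

definition distance_magic_labeling :: "'a pair_pre_digraph \<Rightarrow> ('a \<Rightarrow> nat) \<Rightarrow> bool" where
  "distance_magic_labeling G f \<longleftrightarrow>
     bij_betw f (pverts G) {1..card (pverts G)} \<and>
     (\<exists>c. \<forall>u \<in> pverts G. (\<Sum>v \<in> open_nbhd G u. f v) = c)"

definition distance_magic :: "'a pair_pre_digraph \<Rightarrow> bool" where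
  "distance_magic G \<longleftrightarrow> (\<exists>f. distance_magic_labeling G f)"

definition non_distance_magic :: "'a pair_pre_digraph \<Rightarrow> bool" where
  "non_distance_magic G \<longleftrightarrow> \<not> distance_magic G"

end

theory Submission
  imports Defs
begin

text \<open>
  In a distance magic labeling f, any two vertices x, y satisfy
  f(N(x) - N(y)) = f(N(y) - N(x)), since the common part cancels. Hence
  f(N(w1) - N(w2)) \<le> f(N(u1) - N(u2)) = f(N(u2) - N(u1)) \<le> f(N(w2) - N(w1)) = f(N(w1) - N(w2)),
  so both inclusions carry no weight outside the smaller set; labels being positive, both are equalities.
\<close>

text \<open>Both sums contain the weight of \<open>A \<inter> B\<close>. Cancelling it, rather than
  subtracting, lets the result apply to labels in \<open>nat\<close>.\<close>

lemma sum_Diff_eq_sum_Diff: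
  fixes f :: "'a \<Rightarrow> 'b::cancel_comm_monoid_add"
  assumes "finite A" "finite B" "sum f A = sum f B"
  shows "sum f (A - B) = sum f (B - A)"
proof -
  have "sum f (A \<inter> B) + sum f (A - B) = sum f (A \<inter> B) + sum f (B - A)"
    using assms sum.Int_Diff[of A f B] sum.Int_Diff[of B f A] by (simp add: Int_commute)
  then show ?thesis by simp
qed

text \<open>The weight of \<open>B\<close> is that of \<open>A\<close> plus that of
  \<open>B - A\<close>, so the bound leaves weight 0 for \<open>B - A\<close>; with positive weights
  this set must be empty.\<close>

lemma subset_eq_if_sum_le:
  fixes f :: "'a \<Rightarrow> nat"
  assumes "finite B" "A \<subseteq> B" "\<And>x. x \<in> B \<Longrightarrow> 0 < f x" "sum f B \<le> sum f A"
  shows "A = B"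
proof -
  have "sum f (B - A) = 0"
    using assms sum.subset_diff[of A B f] by simp
  moreover have "finite (B - A)"
    using assms(1) by simp
  ultimately have "\<forall>x \<in> B - A. f x = 0"
    by simp
  then have "B \<subseteq> A"
    using assms(3) by (metis DiffI less_irrefl subsetI)
  with assms(2) show ?thesis by (rule subset_antisym)
qed

theorem theorem2p1:
  fixes G :: "'a pair_pre_digraph" and u1 u2 w1 w2 :: 'a
  assumes "pair_graph G"
    and "{u1, u2, w1, w2} \<subseteq> pverts G"
    and "distinct [u1, u2, w1, w2]"
    and "open_nbhd G u1 \<inter> open_nbhd G u2 \<noteq> {}"
    and "open_nbhd G w1 \<inter> open_nbhd G w2 \<noteq> {}"
    and "open_nbhd G u1 - open_nbhd G u2 \<noteq> {}"
    and "open_nbhd G u2 - open_nbhd G u1 \<noteq> {}"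
    and "open_nbhd G w1 - open_nbhd G w2 \<noteq> {}"
    and "open_nbhd G w2 - open_nbhd G w1 \<noteq> {}"
    and "open_nbhd G w1 - open_nbhd G w2 \<subseteq> open_nbhd G u1 - open_nbhd G u2"
    and "open_nbhd G u2 - open_nbhd G u1 \<subseteq> open_nbhd G w2 - open_nbhd G w1"
    and "card ((open_nbhd G u1 - open_nbhd G u2) - (open_nbhd G w1 - open_nbhd G w2))
       + card ((open_nbhd G w2 - open_nbhd G w1) - (open_nbhd G u2 - open_nbhd G u1)) \<ge> 1"
  shows "non_distance_magic G"
proof (unfold non_distance_magic_def, rule notI)
  let ?N = "open_nbhd G"
  let ?D = "\<lambda>x y. ?N x - ?N y"
  assume "distance_magic G"
  then obtain f c where f: "bij_betw f (pverts G) {1..card (pverts G)}"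
    and c: "\<And>u. u \<in> pverts G \<Longrightarrow> sum f (?N u) = c"
    unfolding distance_magic_def distance_magic_labeling_def by blast
  interpret pair_graph G by fact
  have fin: "finite (?N u)" for u
    unfolding open_nbhd_def by simp
  \<comment> \<open>Labels start at 1, and neighbours are vertices by definition.\<close>
  have pos: "0 < f v" if "v \<in> ?N u" for u v
    using bij_betwE[OF f] that unfolding open_nbhd_def by fastforce
  have u: "sum f (?D u1 u2) = sum f (?D u2 u1)" and w: "sum f (?D w1 w2) = sum f (?D w2 w1)"
    using assms(2) by (auto intro!: sum_Diff_eq_sum_Diff simp: fin c)
  have wu: "sum f (?D w1 w2) \<le> sum f (?D u1 u2)" and uw: "sum f (?D u2 u1) \<le> sum f (?D w2 w1)"
    using assms(10,11) by (auto intro!: sum_mono2 simp: fin)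
  \<comment> \<open>Each inclusion becomes an equality through the other one: here the larger set is
    bounded by going from \<open>?D u1 u2\<close> to \<open>?D u2 u1\<close>, up to
    \<open>?D w2 w1\<close>, and back to \<open>?D w1 w2\<close>.\<close>
  have "?D w1 w2 = ?D u1 u2"
    using fin assms(10) pos u w uw by (intro subset_eq_if_sum_le[where f = f]) auto
  moreover have "?D u2 u1 = ?D w2 w1"
    using fin assms(11) pos u w wu by (intro subset_eq_if_sum_le[where f = f]) auto
  \<comment> \<open>Both differences counted in hypothesis (iii) are now empty, so the cardinalities
    add up to 0.\<close>
  ultimately show False using assms(12) by simp
qed

end
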